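(* Let $x\mapsto|\psi_x\rangle$ be a differentiable family of unit vectors in a complex Hilbert space, and fix a value of $x$ with $I(\rho_x)>0$, where $\rho_x=|\psi_x\rangle\langle\psi_x|$. Let $\{K_\omega\}_{\omega\in\Omega}$ be a post-selection measurement with POVM operators $E_\omega=K_\omega^\dagger K_\omega$ and set of retained outcomes $\checkmark\subset\Omega$, and suppose that it is an efficient lossless compression channel for $|\psi_x\rangle$ at $x$. Then $$\Big\langle\psi_x^\perp\Big|\sum_{\omega\in\checkmark}E_\omega\Big|\psi_x^\perp\Big\rangle=1,$$ $$\langle\partial_x^\perp\psi_x|E_\omega|\psi_x\rangle=0\quad\text{for every }\omega\in\checkmark,$$ with $p(\omega|x)>0$ for every $\omega\in\checkmark$ and $\sum_{\omega\in\checkmark}p(\omega|x)<1$.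
   Context: Notation. $|\partial_x^\perp\psi_x\rangle=|\partial_x\psi_x\rangle-\langle\psi_x|\partial_x\psi_x\rangle|\psi_x\rangle$, $g(\rho_x)=\langle\partial_x^\perp\psi_x|\partial_x^\perp\psi_x\rangle$, $|\psi_x^\perp\rangle=|\partial_x^\perp\psi_x\rangle/\sqrt{g(\rho_x)}$. The quantum Fisher information (QFI) of a pure state given by unit vectors $|\chi_x\rangle$ is $4\left(\langle\partial_x\chi_x|\partial_x\chi_x\rangle-|\langle\chi_x|\partial_x\chi_x\rangle|^2\right)$; in particular $I(\rho_x)=4g(\rho_x)$. Post-selection. A post-selection measurement is a finite family of bounded operators $\{K_\omega\}_{\omega\in\Omega}$ with $E_\omega=K_\omega^\dagger K_\omega$ and $\sum_{\omega\in\Omega}E_\omega=\mathbb I$, with the outcome set split as $\Omega=\checkmark\cup\times$ into disjoint sets of retained (desired) and discarded (undesired) outcomes. The $K_\omega$ are held fixed when differentiating in $x$ (only $|\psi_x\rangle$ is differentiated). Put $p(\omega|x)=\langle\psi_x|E_\omega|\psi_x\rangle$ and let $\sigma_{x|\omega}$ be the pure state with unit vector $K_\omega|\psi_x\rangle/\sqrt{p(\omega|x)}$, with QFI $I(\sigma_{x|\omega})$. Retained outcomes are always required to have $p(\omega|x)\neq0$ (no null POVM operator is retained). The loss is $\gamma=1-\sum_{\omega\in\checkmark}p(\omega|x)I(\sigma_{x|\omega})/I(\rho_x)$ and the compression capacity is $c=1/\sum_{\omega\in\checkmark}p(\omega|x)$. The measurement is a lossless compression channel (LCC) if $\gamma=0$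 and $c>1$; it is efficient if $c\in(1,\infty)$. *)

theory Defs
  imports "HOL-Analysis.Analysis"
begin

section \<open>Complex Hilbert spaces\<close>

text \<open>
  A complex inner product space is presented as a real inner product space with a compatible
  scalar multiplication by complex numbers and a complex inner product whose real part is the real
  one. The norm and the topology are therefore those induced by the complex inner product, and
  the library's derivatives of curves apply. The inner product is linear in the
  \<^emph>\<open>second\<close> argument, so that \<open>cinner u v\<close> is the bracket of the bra \<open>u\<close> with the ket \<open>v\<close>.
\<close>

class complex_inner = real_inner +
  fixes scaleC :: "complex \<Rightarrow> 'a \<Rightarrow> 'a" (infixr "*\<^sub>C" 75)
    and cinner :: "'a \<Rightarrow> 'a \<Rightarrow> complex"
  assumes scaleC_add_right: "a *\<^sub>C (u + v) = a *\<^sub>C u + a *\<^sub>C v"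
    and scaleC_add_left: "(a + b) *\<^sub>C u = a *\<^sub>C u + b *\<^sub>C u"
    and scaleC_scaleC: "a *\<^sub>C (b *\<^sub>C u) = (a * b) *\<^sub>C u"
    and scaleR_eq_scaleC: "r *\<^sub>R u = complex_of_real r *\<^sub>C u"
    and cinner_commute: "cinner u v = cnj (cinner v u)"
    and cinner_add_right: "cinner u (v + w) = cinner u v + cinner u w"
    and cinner_scaleC_right: "cinner u (a *\<^sub>C v) = a * cinner u v"
    and inner_eq_Re_cinner: "inner u v = Re (cinner u v)"

class complex_hilbert = complex_inner + complete_space

lemma cinner_self: "cinner u u = complex_of_real ((norm u)\<^sup>2)"
  for u :: "'a::complex_inner"
proof -
  have "Im (cinner u u) = 0"
    using arg_cong[OF cinner_commute[of u u], of Im] by simp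
  thus ?thesis
    by (simp add: complex_eq_iff power2_norm_eq_inner inner_eq_Re_cinner)
qed

instantiation complex :: complex_hilbert
begin

definition scaleC_complex :: "complex \<Rightarrow> complex \<Rightarrow> complex"
  where "scaleC_complex a z = a * z"

definition cinner_complex :: "complex \<Rightarrow> complex \<Rightarrow> complex"
  where "cinner_complex z w = cnj z * w"

instance
  by standard (auto simp: scaleC_complex_def cinner_complex_def inner_complex_def algebra_simps
      complex_eq_iff)

end

instantiation vec :: (complex_inner, finite) complex_inner
begin

definition scaleC_vec :: "complex \<Rightarrow> 'a ^ 'b \<Rightarrow> 'a ^ 'b"
  where "scaleC_vec a u = (\<chi> i. a *\<^sub>C (u $ i))"

definition cinner_vec :: "'a ^ 'b \<Rightarrow> 'a ^ 'b \<Rightarrow> complex"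
  where "cinner_vec u v = (\<Sum>i\<in>UNIV. cinner (u $ i) (v $ i))"

instance
proof
  fix u v :: "'a ^ 'b"
  show "cinner u v = cnj (cinner v u)"
    unfolding cinner_vec_def cnj_sum by (rule sum.cong[OF refl], rule cinner_commute)
qed (simp_all add: scaleC_vec_def cinner_vec_def inner_vec_def vec_eq_iff scaleC_add_right
      scaleC_add_left scaleC_scaleC scaleR_eq_scaleC cinner_add_right cinner_scaleC_right
      inner_eq_Re_cinner sum.distrib sum_distrib_left)

end

instance vec :: (complex_hilbert, finite) complex_hilbert ..


section \<open>Bounded operators and their adjoints\<close>

definition bounded_clinear :: "('a::complex_inner \<Rightarrow> 'b::complex_inner) \<Rightarrow> bool"
  where "bounded_clinear f \<longleftrightarrow> bounded_linear f \<and> (\<forall>a u. f (a *\<^sub>C u) = a *\<^sub>C f u)"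

definition cadjoint :: "('a::complex_hilbert \<Rightarrow> 'b::complex_hilbert) \<Rightarrow> 'b \<Rightarrow> 'a"
  where "cadjoint f = (THE g. \<forall>u v. cinner (g u) v = cinner u (f v))"

text \<open>
  The adjoint of a bounded operator exists by the Riesz representation theorem, which is obtained
  here by minimising \<open>inner u u / 2 - \<phi> u\<close>.
\<close>

lemma riesz_representation:
  fixes \<phi> :: "'a::{real_inner, complete_space} \<Rightarrow> real"
  assumes "bounded_linear \<phi>"
  shows "\<exists>u. \<forall>v. inner u v = \<phi> v"
proof -
  interpret \<phi>: bounded_linear \<phi> by fact
  define J where "J u = inner u u / 2 - \<phi> u" for u
  obtain B where B: "\<And>u. \<bar>\<phi> u\<bar> \<le> norm u * B"
    using \<phi>.nonneg_bounded by auto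
  have lower: "- (B\<^sup>2 / 2) \<le> J u" for u
  proof -
    have "0 \<le> (norm u - B)\<^sup>2" by simp
    hence "norm u * B \<le> (norm u)\<^sup>2 / 2 + B\<^sup>2 / 2"
      by (simp add: power2_diff)
    with B[of u] show ?thesis
      by (simp add: J_def power2_norm_eq_inner)
  qed
  have bdd: "bdd_below (range J)"
    using lower by (intro bdd_belowI[of _ "- (B\<^sup>2 / 2)"]) auto
  define m where "m = Inf (range J)"
  have m_le: "m \<le> J u" for u
    unfolding m_def by (rule cInf_lower[OF _ bdd]) simp
  have "\<exists>u. J u < m + inverse (real (Suc n))" for n
  proof -
    have "Inf (range J) < m + inverse (real (Suc n))"
      by (simp add: m_def)
    thus ?thesis
      using cInf_lessD[of "range J"] by auto
  qed
  then obtain U where U: "\<And>n. J (U n) < m + inverse (real (Suc n))"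
    by metis
  have par: "(norm (a - b))\<^sup>2 \<le> 4 * (J a - m) + 4 * (J b - m)" for a b
  proof -
    have "J a + J b - 2 * J ((1/2) *\<^sub>R (a + b)) = (norm (a - b))\<^sup>2 / 4"
      by (simp add: J_def power2_norm_eq_inner \<phi>.add \<phi>.scaleR inner_simps inner_commute[of b a]
          field_simps)
    with m_le[of "(1/2) *\<^sub>R (a + b)"] show ?thesis by simp
  qed
  have "Cauchy U"
  proof (rule metric_CauchyI)
    fix e :: real assume e: "e > 0"
    obtain N where N: "inverse (real (Suc N)) < e\<^sup>2 / 8"
      using reals_Archimedean[of "e\<^sup>2 / 8"] e by auto
    have close: "J (U n) - m < e\<^sup>2 / 8" if "n \<ge> N" for n
    proof -
      have "inverse (real (Suc n)) \<le> inverse (real (Suc N))"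
        using that by (simp add: field_simps)
      with U[of n] N show ?thesis by linarith
    qed
    have "dist (U a) (U b) < e" if "a \<ge> N" "b \<ge> N" for a b
    proof -
      note par[of "U a" "U b"]
      also have "4 * (J (U a) - m) + 4 * (J (U b) - m) < 4 * (e\<^sup>2 / 8) + 4 * (e\<^sup>2 / 8)"
        by (intro add_strict_mono mult_strict_left_mono close that) simp_all
      finally have "(norm (U a - U b))\<^sup>2 < e\<^sup>2" by simp
      thus ?thesis
        using e by (simp add: dist_norm power_less_imp_less_base)
    qed
    thus "\<exists>M. \<forall>a\<ge>M. \<forall>b\<ge>M. dist (U a) (U b) < e" by blast
  qed
  then obtain l where l: "U \<longlonglongrightarrow> l"
    using Cauchy_convergent_iff convergent_def by blast
  have "(\<lambda>n. J (U n)) \<longlonglongrightarrow> J l"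
    unfolding J_def by (intro tendsto_intros \<phi>.tendsto l) simp
  moreover have "(\<lambda>n. m + inverse (real (Suc n))) \<longlonglongrightarrow> m + 0"
    by (intro tendsto_intros LIMSEQ_inverse_real_of_nat)
  ultimately have "J l \<le> m + 0"
    by (rule LIMSEQ_le) (use U less_imp_le in blast)
  hence minimal: "J l \<le> J u" for u
    using m_le[of u] by simp
  have "inner l v = \<phi> v" for v
  proof (rule ccontr)
    define d where "d = inner l v - \<phi> v"
    define q where "q = inner v v"
    define t where "t = - d / (q + 1)"
    assume "inner l v \<noteq> \<phi> v"
    hence d: "d \<noteq> 0" by (simp add: d_def)
    have q: "q \<ge> 0" by (simp add: q_def)
    have tq: "t * (q + 1) = - d"
      using q by (simp add: t_def)
    have "t \<noteq> 0" using tq d by auto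
    hence pos: "t\<^sup>2 > 0" by simp
    have "J (l + t *\<^sub>R v) = J l + t * d + t\<^sup>2 * q / 2"
      by (simp add: J_def d_def q_def \<phi>.add \<phi>.scaleR inner_simps inner_commute[of v l]
          field_simps power2_eq_square)
    with minimal[of "l + t *\<^sub>R v"] have "0 \<le> t * d + t\<^sup>2 * q / 2" by simp
    also have "t * d = - (t\<^sup>2 * (q + 1))"
      using arg_cong[OF tq, of "\<lambda>z. - (t * z)"] by (simp add: power2_eq_square mult.assoc)
    finally have "t\<^sup>2 * (q / 2 + 1) \<le> 0"
      by (simp add: algebra_simps)
    moreover have "0 < t\<^sup>2 * (q / 2 + 1)"
      using pos q by (intro mult_pos_pos) auto
    ultimately show False by linarith
  qed
  thus ?thesis by blast
qed

lemma cinner_ext: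
  fixes u w :: "'a::complex_inner"
  assumes "\<And>v. cinner u v = cinner w v"
  shows "u = w"
proof -
  have "inner u v = inner w v" for v
    by (simp add: inner_eq_Re_cinner assms)
  thus ?thesis
    by (metis vector_eq_rdot)
qed

lemma cinner_cadjoint_left:
  fixes f :: "'a::complex_hilbert \<Rightarrow> 'b::complex_hilbert"
  assumes f: "bounded_clinear f"
  shows "cinner (cadjoint f u) v = cinner u (f v)"
proof -
  have bl: "bounded_linear f" and C: "\<And>a u. f (a *\<^sub>C u) = a *\<^sub>C f u"
    using f by (auto simp: bounded_clinear_def)
  have "\<exists>w. \<forall>v. cinner w v = cinner u (f v)" for u
  proof -
    have "bounded_linear (\<lambda>v. inner u (f v))"
      by (rule bounded_linear_inner_right_comp[OF bl])
    then obtain w where w: "\<And>v. inner w v = inner u (f v)"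
      using riesz_representation by blast
    have "cinner w v = cinner u (f v)" for v
      using w[of v] w[of "\<i> *\<^sub>C v"]
      by (simp add: inner_eq_Re_cinner C cinner_scaleC_right complex_eq_iff)
    thus ?thesis by blast
  qed
  then obtain g where g: "\<forall>u v. cinner (g u) v = cinner u (f v)"
    by metis
  have "\<forall>u v. cinner (cadjoint f u) v = cinner u (f v)"
    unfolding cadjoint_def
  proof (rule theI[where P = "\<lambda>g. \<forall>u v. cinner (g u) v = cinner u (f v)"])
    show "\<forall>u v. cinner (g u) v = cinner u (f v)" by fact
  next
    fix h assume h: "\<forall>u v. cinner (h u) v = cinner u (f v)"
    have "h u = g u" for u
      by (rule cinner_ext) (simp add: g h)
    thus "h = g" by blast
  qed
  thus ?thesis by blast
qed


section \<open>Families of pure states and quantum Fisher information\<close>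

text \<open>
  A family of pure states is a curve \<open>\<psi>\<close> of unit vectors; its derivative in the parameter is
  \<open>vector_derivative \<psi> (at x)\<close>.
\<close>

definition perp_deriv :: "(real \<Rightarrow> 'a::complex_inner) \<Rightarrow> real \<Rightarrow> 'a"
  where "perp_deriv \<psi> x =
    vector_derivative \<psi> (at x) - cinner (\<psi> x) (vector_derivative \<psi> (at x)) *\<^sub>C \<psi> x"

definition fubini_study :: "(real \<Rightarrow> 'a::complex_inner) \<Rightarrow> real \<Rightarrow> real"
  where "fubini_study \<psi> x = Re (cinner (perp_deriv \<psi> x) (perp_deriv \<psi> x))"

definition perp_state :: "(real \<Rightarrow> 'a::complex_inner) \<Rightarrow> real \<Rightarrow> 'a"
  where "perp_state \<psi> x = (1 / sqrt (fubini_study \<psi> x)) *\<^sub>R perp_deriv \<psi> x"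

definition qfi :: "(real \<Rightarrow> 'a::complex_inner) \<Rightarrow> real \<Rightarrow> real"
  where "qfi \<phi> x =
    4 * (Re (cinner (vector_derivative \<phi> (at x)) (vector_derivative \<phi> (at x)))
         - (cmod (cinner (\<phi> x) (vector_derivative \<phi> (at x))))\<^sup>2)"


section \<open>Post-selection\<close>

definition povm :: "('w \<Rightarrow> 'a \<Rightarrow> 'a::complex_hilbert) \<Rightarrow> 'w \<Rightarrow> 'a \<Rightarrow> 'a"
  where "povm K \<omega> = cadjoint (K \<omega>) \<circ> K \<omega>"

definition post_selection_measurement ::
  "('w \<Rightarrow> 'a \<Rightarrow> 'a::complex_hilbert) \<Rightarrow> 'w set \<Rightarrow> 'w set \<Rightarrow> 'w set \<Rightarrow> bool"
  where "post_selection_measurement K \<Omega> retained discarded \<longleftrightarrow>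
    finite \<Omega> \<and> \<Omega> = retained \<union> discarded \<and> retained \<inter> discarded = {} \<and>
    (\<forall>\<omega>\<in>\<Omega>. bounded_clinear (K \<omega>)) \<and>
    (\<forall>v. (\<Sum>\<omega>\<in>\<Omega>. povm K \<omega> v) = v)"

definition outcome_prob ::
  "('w \<Rightarrow> 'a \<Rightarrow> 'a::complex_hilbert) \<Rightarrow> (real \<Rightarrow> 'a) \<Rightarrow> real \<Rightarrow> 'w \<Rightarrow> real"
  where "outcome_prob K \<psi> x \<omega> = Re (cinner (\<psi> x) (povm K \<omega> (\<psi> x)))"

text \<open>
  The post-selected state is a curve in its own right: the normalisation depends on the parameter
  and is differentiated along with \<open>\<psi>\<close> when \<^const>\<open>qfi\<close> is applied.
\<close>

definition post_state ::
  "('w \<Rightarrow> 'a \<Rightarrow> 'a::complex_hilbert) \<Rightarrow> (real \<Rightarrow> 'a) \<Rightarrow> 'w \<Rightarrow> real \<Rightarrow> 'a"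
  where "post_state K \<psi> \<omega> y = (1 / sqrt (outcome_prob K \<psi> y \<omega>)) *\<^sub>R K \<omega> (\<psi> y)"

definition loss ::
  "('w \<Rightarrow> 'a \<Rightarrow> 'a::complex_hilbert) \<Rightarrow> 'w set \<Rightarrow> (real \<Rightarrow> 'a) \<Rightarrow> real \<Rightarrow> real"
  where "loss K retained \<psi> x =
    1 - (\<Sum>\<omega>\<in>retained. outcome_prob K \<psi> x \<omega> * qfi (post_state K \<psi> \<omega>) x) / qfi \<psi> x"

text \<open>The capacity is extended-real valued: it is \<open>\<infinity>\<close> when the retained probability vanishes.\<close>

definition capacity ::
  "('w \<Rightarrow> 'a \<Rightarrow> 'a::complex_hilbert) \<Rightarrow> 'w set \<Rightarrow> (real \<Rightarrow> 'a) \<Rightarrow> real \<Rightarrow> ereal"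
  where "capacity K retained \<psi> x = 1 / ereal (\<Sum>\<omega>\<in>retained. outcome_prob K \<psi> x \<omega>)"

definition lossless_compression_channel ::
  "('w \<Rightarrow> 'a \<Rightarrow> 'a::complex_hilbert) \<Rightarrow> 'w set \<Rightarrow> (real \<Rightarrow> 'a) \<Rightarrow> real \<Rightarrow> bool"
  where "lossless_compression_channel K retained \<psi> x \<longleftrightarrow>
    loss K retained \<psi> x = 0 \<and> 1 < capacity K retained \<psi> x"

definition efficient ::
  "('w \<Rightarrow> 'a \<Rightarrow> 'a::complex_hilbert) \<Rightarrow> 'w set \<Rightarrow> (real \<Rightarrow> 'a) \<Rightarrow> real \<Rightarrow> bool"
  where "efficient K retained \<psi> x \<longleftrightarrow>
    1 < capacity K retained \<psi> x \<and> capacity K retained \<psi> x < \<infinity>"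

end

theory Submission
  imports Defs
begin

text \<open>
  Write \<open>d\<close> for the component of the derivative of \<open>\<psi>\<close> orthogonal to \<open>\<psi>\<close>. The quantum Fisher
  information of a normalised curve is four times the Gram determinant of the state and its
  derivative. This determinant ignores multiples of the state in the second argument, so each
  retained outcome contributes
  \<open>p I = 4 (\<parallel>K d\<parallel>\<^sup>2 - \<bar>\<langle>K \<psi>, K d\<rangle>\<bar>\<^sup>2 / p)\<close>. By completeness \<open>I(\<rho>) = 4 \<parallel>d\<parallel>\<^sup>2\<close> is \<open>4 \<parallel>K d\<parallel>\<^sup>2\<close> summed over
  all outcomes; subtracting, losslessness says that the sum of the nonnegative
  terms \<open>\<parallel>K d\<parallel>\<^sup>2\<close> over discarded and \<open>\<bar>\<langle>K \<psi>, K d\<rangle>\<bar>\<^sup>2 / p\<close> over retained outcomes is zero.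
\<close>

lemma cinner_add_left: "cinner (u + v) w = cinner u w + cinner v w"
  for u v w :: "'a::complex_inner"
  by (metis cinner_commute cinner_add_right complex_cnj_add)

lemma cinner_scaleC_left: "cinner (a *\<^sub>C u) v = cnj a * cinner u v"
  for u v :: "'a::complex_inner"
  by (metis cinner_commute cinner_scaleC_right complex_cnj_mult)

lemma cinner_scaleR_left: "cinner (r *\<^sub>R u) v = of_real r * cinner u v"
  and cinner_scaleR_right: "cinner u (r *\<^sub>R v) = of_real r * cinner u v"
  for u v :: "'a::complex_inner"
  by (simp_all add: scaleR_eq_scaleC cinner_scaleC_left cinner_scaleC_right)

lemma cinner_zero_right [simp]: "cinner u 0 = 0"
  for u :: "'a::complex_inner"
  using cinner_scaleR_right[of u 0 u] by simp

lemma cinner_sum_right: "cinner u (\<Sum>i\<in>A. f i) = (\<Sum>i\<in>A. cinner u (f i))"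
  for u :: "'a::complex_inner"
  by (induction A rule: infinite_finite_induct) (simp_all add: cinner_add_right)

text \<open>Brings the subtraction in \<open>perp_deriv\<close> into the shift form of
  \<open>gram_scale_shift\<close>. Negation is tied to the complex scalars only through real scaling
  by -1.\<close>

lemma diff_eq_add_scaleC: "u - a *\<^sub>C v = u + (- a) *\<^sub>C v"
  for u v :: "'a::complex_inner"
  using scaleR_eq_scaleC[of "-1" "a *\<^sub>C v"] by (simp add: scaleC_scaleC)

definition gram :: "'a::complex_inner \<Rightarrow> 'a \<Rightarrow> real"
  where "gram u v = (norm u)\<^sup>2 * (norm v)\<^sup>2 - (cmod (cinner u v))\<^sup>2"

text \<open>Over the complex numbers the determinant is a polynomial in inner products, which
  sesquilinearity can expand; the form with \<open>cmod\<close> does not expand this way.\<close>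

lemma of_real_gram:
  "complex_of_real (gram u v) = cinner u u * cinner v v - cinner u v * cinner v u"
proof -
  have "cinner u v * cinner v u = complex_of_real ((cmod (cinner u v))\<^sup>2)"
    by (subst cinner_commute[of v u]) (simp only: complex_norm_square)
  thus ?thesis
    by (simp add: gram_def cinner_self)
qed

text \<open>Column operations on a determinant: multiples of \<open>u\<close> drop out of the second
  vector, and each real factor appears once in the bra and once in the ket, hence squared. It
  handles both the projection in \<open>perp_deriv\<close> and the derivative of a normalising
  factor.\<close>

lemma gram_scale_shift:
  "gram (a *\<^sub>R u) (b *\<^sub>R v + c *\<^sub>C u) = a\<^sup>2 * b\<^sup>2 * gram u v"
proof -
  have "complex_of_real (gram (a *\<^sub>R u) (b *\<^sub>R v + c *\<^sub>C u)) = of_real (a\<^sup>2 * b\<^sup>2 * gram u v)"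
    by (simp add: of_real_gram cinner_add_left cinner_add_right cinner_scaleC_left
        cinner_scaleC_right cinner_scaleR_left cinner_scaleR_right power2_eq_square algebra_simps)
  thus ?thesis
    by (simp only: of_real_eq_iff)
qed

lemma qfi_unit:
  assumes "norm (\<phi> x) = 1"
  shows "qfi \<phi> x = 4 * gram (\<phi> x) (vector_derivative \<phi> (at x))"
  using assms by (simp add: qfi_def gram_def cinner_self)

lemma gram_perp_deriv:
  "gram (\<psi> x) (perp_deriv \<psi> x) = gram (\<psi> x) (vector_derivative \<psi> (at x))"
  using gram_scale_shift[of 1 "\<psi> x" 1 "vector_derivative \<psi> (at x)"]
  by (simp add: perp_deriv_def diff_eq_add_scaleC)

lemma cinner_perp_deriv:
  assumes "norm (\<psi> x) = 1"
  shows "cinner (\<psi> x) (perp_deriv \<psi> x) = 0"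
  using assms
  by (simp add: perp_deriv_def diff_eq_add_scaleC cinner_add_right cinner_scaleC_right cinner_self)

lemma fubini_study_norm: "fubini_study \<psi> x = (norm (perp_deriv \<psi> x))\<^sup>2"
  by (simp add: fubini_study_def cinner_self)

lemma qfi_eq_fubini_study:
  assumes "norm (\<psi> x) = 1"
  shows "qfi \<psi> x = 4 * fubini_study \<psi> x"
proof -
  have "gram (\<psi> x) (perp_deriv \<psi> x) = fubini_study \<psi> x"
    using assms cinner_perp_deriv[where \<psi> = \<psi>, OF assms] by (simp add: gram_def fubini_study_norm)
  thus ?thesis
    using qfi_unit[where \<phi> = \<psi>, OF assms] by (simp add: gram_perp_deriv)
qed

lemma cinner_povm:
  assumes "bounded_clinear (K \<omega>)"
  shows "cinner u (povm K \<omega> v) = cinner (K \<omega> u) (K \<omega> v)"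
  by (metis assms cinner_cadjoint_left cinner_commute comp_apply povm_def)

lemma outcome_prob_norm:
  assumes "bounded_clinear (K \<omega>)"
  shows "outcome_prob K \<psi> x \<omega> = (norm (K \<omega> (\<psi> x)))\<^sup>2"
  by (simp add: outcome_prob_def cinner_povm assms cinner_self)

text \<open>Product rule; \<open>norm\<close> is differentiable away from 0. The value of
  \<open>b\<close> is left open because its term is parallel to the state and disappears from the
  Gram determinant. The root of a squared norm matches \<open>post_state\<close> once the outcome
  probability is written as a norm.\<close>

lemma vector_derivative_normalize:
  fixes \<phi> :: "real \<Rightarrow> 'a::real_inner"
  assumes \<phi>: "(\<phi> has_vector_derivative D) (at x)" and nz: "\<phi> x \<noteq> 0"
  shows "\<exists>b. vector_derivative (\<lambda>y. (1 / sqrt ((norm (\<phi> y))\<^sup>2)) *\<^sub>R \<phi> y) (at x)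
    = (1 / norm (\<phi> x)) *\<^sub>R D + b *\<^sub>R \<phi> x"
proof -
  have "(\<lambda>y. 1 / norm (\<phi> y)) differentiable (at x)"
    using \<phi> nz
    by (intro differentiable_divide differentiable_const
        differentiable_compose[of norm \<phi> x UNIV] differentiable_norm_at)
       (auto intro: differentiableI_vector)
  then obtain b where "((\<lambda>y. 1 / norm (\<phi> y)) has_real_derivative b) (at x)"
    by (auto simp: real_differentiable_def)
  from has_vector_derivative_scaleR[OF this \<phi>]
  have "((\<lambda>y. (1 / norm (\<phi> y)) *\<^sub>R \<phi> y) has_vector_derivative
      (1 / norm (\<phi> x)) *\<^sub>R D + b *\<^sub>R \<phi> x) (at x)" .
  thus ?thesis
    by (auto intro: vector_derivative_at)
qed

lemma outcome_qfi:
  fixes K :: "'w \<Rightarrow> 'a \<Rightarrow> 'a::complex_hilbert"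
  assumes K: "bounded_clinear (K \<omega>)" and \<psi>: "\<psi> differentiable (at x)"
    and p: "outcome_prob K \<psi> x \<omega> \<noteq> 0"
  shows "outcome_prob K \<psi> x \<omega> * qfi (post_state K \<psi> \<omega>) x =
    4 * ((norm (K \<omega> (perp_deriv \<psi> x)))\<^sup>2
      - (cmod (cinner (K \<omega> (\<psi> x)) (K \<omega> (perp_deriv \<psi> x))))\<^sup>2 / outcome_prob K \<psi> x \<omega>)"
proof -
  define D where "D = vector_derivative \<psi> (at x)"
  define \<phi> where "\<phi> y = K \<omega> (\<psi> y)" for y
  define n where "n = norm (\<phi> x)"
  interpret K: bounded_linear "K \<omega>"
    using K by (simp add: bounded_clinear_def)
  have KC: "K \<omega> (a *\<^sub>C u) = a *\<^sub>C K \<omega> u" for a u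
    using K by (simp add: bounded_clinear_def)
  have prob: "outcome_prob K \<psi> y \<omega> = (norm (\<phi> y))\<^sup>2" for y
    by (simp add: outcome_prob_norm K \<phi>_def)
  have n: "n > 0"
    using p by (simp add: prob n_def)
  have "(\<psi> has_vector_derivative D) (at x)"
    using \<psi> by (simp add: D_def vector_derivative_works)
  hence "(\<phi> has_vector_derivative K \<omega> D) (at x)"
    unfolding \<phi>_def by (rule K.has_vector_derivative)
  \<comment> \<open>The equality is between whole curves, since the normalisation is differentiated
    too.\<close>
  moreover have "post_state K \<psi> \<omega> = (\<lambda>y. (1 / sqrt ((norm (\<phi> y))\<^sup>2)) *\<^sub>R \<phi> y)"
    by (simp add: fun_eq_iff post_state_def prob \<phi>_def)
  ultimately obtain b where
    b: "vector_derivative (post_state K \<psi> \<omega>) (at x) = (1 / n) *\<^sub>R K \<omega> D + b *\<^sub>R \<phi> x"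
    using vector_derivative_normalize[of \<phi> "K \<omega> D" x] n by (auto simp: n_def)
  have ps: "post_state K \<psi> \<omega> x = (1 / n) *\<^sub>R \<phi> x"
    by (simp add: post_state_def prob \<phi>_def n_def)
  \<comment> \<open>State and derivative each carry a factor \<open>1 / n\<close>, which the
    determinant squares: together \<open>1 / n ^ 4\<close>. Multiplying by the probability
    \<open>n\<^sup>2\<close> leaves \<open>1 / n\<^sup>2\<close>.\<close>
  have "gram (post_state K \<psi> \<omega> x) (vector_derivative (post_state K \<psi> \<omega>) (at x))
      = gram (\<phi> x) (K \<omega> D) / n ^ 4"
    by (simp add: b ps gram_scale_shift scaleR_eq_scaleC[of b] power_divide)
  moreover have "norm (post_state K \<psi> \<omega> x) = 1"
    using n by (simp add: ps n_def)
  ultimately have "qfi (post_state K \<psi> \<omega>) x = 4 * gram (\<phi> x) (K \<omega> D) / n ^ 4"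
    by (simp add: qfi_unit)
  \<comment> \<open>Linearity of \<open>K \<omega>\<close> turns the projection along
    \<open>\<psi> x\<close> into a shift along \<open>\<phi> x\<close>, so the determinant cannot
    tell \<open>D\<close> from its orthogonal part.\<close>
  moreover have "K \<omega> (perp_deriv \<psi> x) = 1 *\<^sub>R K \<omega> D + (- cinner (\<psi> x) D) *\<^sub>C \<phi> x"
    by (simp add: perp_deriv_def D_def diff_eq_add_scaleC K.add KC \<phi>_def)
  hence "gram (\<phi> x) (K \<omega> (perp_deriv \<psi> x)) = gram (\<phi> x) (K \<omega> D)"
    using gram_scale_shift[of 1 "\<phi> x" 1 "K \<omega> D"] by simp
  ultimately have "n\<^sup>2 * qfi (post_state K \<psi> \<omega>) x =
      4 * (gram (\<phi> x) (K \<omega> (perp_deriv \<psi> x)) / n\<^sup>2)"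
    using n by (simp add: field_simps power_eq_if)
  also have "gram (\<phi> x) (K \<omega> (perp_deriv \<psi> x)) / n\<^sup>2 =
      (norm (K \<omega> (perp_deriv \<psi> x)))\<^sup>2 - (cmod (cinner (\<phi> x) (K \<omega> (perp_deriv \<psi> x))))\<^sup>2 / n\<^sup>2"
    using n by (simp add: gram_def n_def diff_divide_distrib)
  finally show ?thesis
    by (simp add: prob \<phi>_def n_def)
qed

text \<open>Completeness of the POVM, taken between \<open>v\<close> and itself.\<close>

lemma sum_norm_outcomes:
  assumes "post_selection_measurement K \<Omega> retained discarded"
  shows "(\<Sum>\<omega>\<in>\<Omega>. (norm (K \<omega> v))\<^sup>2) = (norm v)\<^sup>2"
proof -
  have "complex_of_real ((norm v)\<^sup>2) = cinner v (\<Sum>\<omega>\<in>\<Omega>. povm K \<omega> v)"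
    using assms unfolding post_selection_measurement_def by (metis cinner_self)
  also have "\<dots> = complex_of_real (\<Sum>\<omega>\<in>\<Omega>. (norm (K \<omega> v))\<^sup>2)"
    unfolding cinner_sum_right of_real_sum
    using assms
    by (intro sum.cong) (auto simp: post_selection_measurement_def cinner_povm cinner_self)
  finally show ?thesis
    by (simp only: of_real_eq_iff)
qed

theorem theorem1:
  fixes \<psi> :: "real \<Rightarrow> 'a::complex_hilbert"
    and X :: "real set" and x :: real
    and K :: "'w \<Rightarrow> 'a \<Rightarrow> 'a"
    and \<Omega> retained discarded :: "'w set"
  assumes "open X" and "x \<in> X"
    and "\<And>y. y \<in> X \<Longrightarrow> norm (\<psi> y) = 1"
    and "\<And>y. y \<in> X \<Longrightarrow> \<psi> differentiable (at y)"
    and "qfi \<psi> x > 0"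
    and "post_selection_measurement K \<Omega> retained discarded"
    and "\<And>\<omega>. \<omega> \<in> retained \<Longrightarrow> outcome_prob K \<psi> x \<omega> \<noteq> 0"
    and "lossless_compression_channel K retained \<psi> x"
    and "efficient K retained \<psi> x"
  shows "cinner (perp_state \<psi> x) (\<Sum>\<omega>\<in>retained. povm K \<omega> (perp_state \<psi> x)) = 1 \<and>
    (\<forall>\<omega>\<in>retained. cinner (perp_deriv \<psi> x) (povm K \<omega> (\<psi> x)) = 0) \<and>
    (\<forall>\<omega>\<in>retained. outcome_prob K \<psi> x \<omega> > 0) \<and>
    (\<Sum>\<omega>\<in>retained. outcome_prob K \<psi> x \<omega>) < 1"
proof -
  define d where "d = perp_deriv \<psi> x"
  define p where "p = outcome_prob K \<psi> x"
  define q where "q \<omega> = (cmod (cinner (K \<omega> (\<psi> x)) (K \<omega> d)))\<^sup>2 / p \<omega>" for \<omega>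
  have fin: "finite retained" "finite discarded" and disj: "retained \<inter> discarded = {}"
    and \<Omega>: "\<Omega> = retained \<union> discarded"
    and K: "\<And>\<omega>. \<omega> \<in> retained \<Longrightarrow> bounded_clinear (K \<omega>)"
    using assms(6) by (auto simp: post_selection_measurement_def)
  have unit: "norm (\<psi> x) = 1" and diff: "\<psi> differentiable (at x)"
    using assms(2-4) by auto
  have p_pos: "p \<omega> > 0" if "\<omega> \<in> retained" for \<omega>
    using assms(7)[OF that] by (simp add: p_def outcome_prob_norm K that)
  have q_nonneg: "q \<omega> \<ge> 0" if "\<omega> \<in> retained" for \<omega>
    using p_pos[OF that] by (simp add: q_def)
  have qfi: "qfi \<psi> x = 4 * (norm d)\<^sup>2"
    by (simp add: qfi_eq_fubini_study unit fubini_study_norm d_def)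
  have "d \<noteq> 0"
    using assms(5) by (auto simp: qfi)
  have "(\<Sum>\<omega>\<in>retained. p \<omega> * qfi (post_state K \<psi> \<omega>) x) = qfi \<psi> x"
    using assms(5,8) by (simp add: lossless_compression_channel_def loss_def p_def field_simps)
  moreover have "(\<Sum>\<omega>\<in>retained. p \<omega> * qfi (post_state K \<psi> \<omega>) x)
      = (\<Sum>\<omega>\<in>retained. 4 * ((norm (K \<omega> d))\<^sup>2 - q \<omega>))"
    unfolding p_def d_def q_def by (intro sum.cong refl outcome_qfi K diff assms(7))
  ultimately have "(\<Sum>\<omega>\<in>retained. (norm (K \<omega> d))\<^sup>2) - (\<Sum>\<omega>\<in>retained. q \<omega>) = (norm d)\<^sup>2"
    by (simp add: qfi sum_subtractf flip: sum_distrib_left)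
  moreover have "(\<Sum>\<omega>\<in>retained. (norm (K \<omega> d))\<^sup>2) + (\<Sum>\<omega>\<in>discarded. (norm (K \<omega> d))\<^sup>2) = (norm d)\<^sup>2"
    using sum_norm_outcomes[OF assms(6), of d] by (simp add: \<Omega> sum.union_disjoint fin disj)
  moreover have "(\<Sum>\<omega>\<in>retained. q \<omega>) \<ge> 0" "(\<Sum>\<omega>\<in>discarded. (norm (K \<omega> d))\<^sup>2) \<ge> 0"
    by (auto intro!: sum_nonneg q_nonneg)
  \<comment> \<open>Subtracting the two balances gives that the sum of \<open>q\<close> plus the
    discarded sum is zero. Both are nonnegative, so both vanish, and the retained outcomes carry all
    of \<open>(norm d)\<^sup>2\<close>.\<close>
  ultimately have sum_q: "(\<Sum>\<omega>\<in>retained. q \<omega>) = 0"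
    and sum_K: "(\<Sum>\<omega>\<in>retained. (norm (K \<omega> d))\<^sup>2) = (norm d)\<^sup>2"
    by linarith+

  have perp_state: "perp_state \<psi> x = (1 / norm d) *\<^sub>R d"
    by (simp add: perp_state_def fubini_study_norm d_def)
  have "cinner (perp_state \<psi> x) (povm K \<omega> (perp_state \<psi> x))
      = complex_of_real ((norm (K \<omega> d))\<^sup>2 / (norm d)\<^sup>2)" if "\<omega> \<in> retained" for \<omega>
  proof -
    have "K \<omega> (perp_state \<psi> x) = (1 / norm d) *\<^sub>R K \<omega> d"
      using K[OF that] by (simp add: perp_state bounded_clinear_def linear_simps)
    thus ?thesis
      using K[OF that] by (simp add: cinner_povm cinner_self power_mult_distrib power_divide)
  qed
  hence "cinner (perp_state \<psi> x) (\<Sum>\<omega>\<in>retained. povm K \<omega> (perp_state \<psi> x))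
      = complex_of_real ((\<Sum>\<omega>\<in>retained. (norm (K \<omega> d))\<^sup>2) / (norm d)\<^sup>2)"
    by (simp add: cinner_sum_right sum_divide_distrib)
  also have "\<dots> = 1"
    using \<open>d \<noteq> 0\<close> by (simp add: sum_K)
  finally have "cinner (perp_state \<psi> x) (\<Sum>\<omega>\<in>retained. povm K \<omega> (perp_state \<psi> x)) = 1" .
  moreover have "cinner d (povm K \<omega> (\<psi> x)) = 0" if "\<omega> \<in> retained" for \<omega>
  proof -
    have "q \<omega> = 0"
      using sum_q that fin q_nonneg by (simp add: sum_nonneg_eq_0_iff)
    hence "cinner (K \<omega> (\<psi> x)) (K \<omega> d) = 0"
      using p_pos[OF that] by (simp add: q_def)
    \<comment> \<open>The bracket in the claim has \<open>d\<close> in the bra, so it is the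
      conjugate of the one measured by \<open>q\<close>.\<close>
    thus ?thesis
      using K[OF that] cinner_commute[of "K \<omega> d"] by (simp add: cinner_povm)
  qed
  moreover have "(\<Sum>\<omega>\<in>retained. p \<omega>) < 1"
  proof (rule ccontr)
    \<comment> \<open>A retained total of at least 1 is nonzero, so the extended-real quotient is an
      ordinary reciprocal, at most 1.\<close>
    assume "\<not> ?thesis"
    hence "capacity K retained \<psi> x \<le> 1"
      by (simp add: capacity_def p_def one_ereal_def)
    thus False
      using assms(9) by (simp add: efficient_def leD)
  qed
  ultimately show ?thesis
    using p_pos by (simp add: d_def p_def)
qed

end
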